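(* Let $\mathbf{a},\mathbf{l},\mathbf{u},\mathbf{y}\in\mathbb{R}^n$ with $\mathbf{l}\leqslant\mathbf{u}$ (componentwise), let $b\in\mathbb{R}$, and assume that the set $$\mathcal{D}_{\mathcal{E}}=\{\mathbf{x}\in\mathbb{R}^n:\ \mathbf{l}\leqslant\mathbf{x}\leqslant\mathbf{u},\ \mathbf{a}^T\mathbf{x}=b\}$$ is non-empty. Then the quadratic program $$\min\ \tfrac12\,\mathbf{x}^T\mathbf{I}\,\mathbf{x}-\mathbf{y}^T\mathbf{x}\quad\text{subject to}\quad \mathbf{a}^T\mathbf{x}=b,\quad \mathbf{l}\leqslant\mathbf{x}\leqslant\mathbf{u}$$ has a unique solution $\mathbf{x}^*$, which is given by $$\mathbf{x}^*=\mathtt{mid}(\mathbf{l},\ \mathbf{y}-\lambda^*\mathbf{a},\ \mathbf{u}),$$ where $\lambda^*\in\mathbb{R}$ is the Lagrange multiplier corresponding to the linear equality constraint $\mathbf{a}^T\mathbf{x}=b$ at the unique KKT point of this quadratic program, and $\lambda^*$ is equal to the unique root of the equation $h(\lambda)=0$, where $$h(\lambda)=b-\sum_{i=1}^n a_i\,\mathtt{mid}(l_i,\ y_i-\lambda a_i,\ u_i).$$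
   Context: $\mathbf{I}$ is the $n\times n$ identity matrix. For scalars, the median operator is $\mathtt{mid}(u,v,w)=\max\{u,\min\{v,w\}\}$; for vectors it is applied componentwise, i.e. $\mathtt{mid}(\mathbf{l},\mathbf{v},\mathbf{u})$ is the vector with $i$-th entry $\mathtt{mid}(l_i,v_i,u_i)$. Vector inequalities are componentwise. The Lagrange multiplier $\lambda$ enters the Lagrangian as $\frac12\mathbf{x}^T\mathbf{x}-\mathbf{y}^T\mathbf{x}+\lambda(\mathbf{a}^T\mathbf{x}-b)$, with the bound constraints $\mathbf{l}\leqslant\mathbf{x}\leqslant\mathbf{u}$ kept explicit. The solution of the quadratic program is the Euclidean projection of $\mathbf{y}$ onto $\mathcal{D}_{\mathcal{E}}$.
   Formalization: The root of h (and the KKT multiplier) need not be unique, e.g. a=0, b=0; the formal theorem shows a root exists and is unique exactly when some root is interior to the set of λ for which some i with a_i≠0 has l_i ≤ y_i−λa_i ≤ u_i. *)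

theory Defs
  imports "HOL-Analysis.Analysis"
begin

definition mid :: "real \<Rightarrow> real \<Rightarrow> real \<Rightarrow> real" where
  "mid u v w = max u (min v w)"

definition vmid :: "real ^ 'n \<Rightarrow> real ^ 'n \<Rightarrow> real ^ 'n \<Rightarrow> real ^ 'n" where
  "vmid l v u = (\<chi> i. mid (l $ i) (v $ i) (u $ i))"

text \<open>The library order on \<^typ>\<open>real ^ 'n\<close> is the componentwise one.\<close>

definition feasible_set :: "real ^ 'n \<Rightarrow> real \<Rightarrow> real ^ 'n \<Rightarrow> real ^ 'n \<Rightarrow> (real ^ 'n) set" where
  "feasible_set a b l u = {x. l \<le> x \<and> x \<le> u \<and> a \<bullet> x = b}"

definition objective :: "real ^ 'n \<Rightarrow> real ^ 'n \<Rightarrow> real" where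
  "objective y x = 1 / 2 * (x \<bullet> (mat 1 *v x)) - y \<bullet> x"

definition qp_solution ::
  "real ^ 'n \<Rightarrow> real \<Rightarrow> real ^ 'n \<Rightarrow> real ^ 'n \<Rightarrow> real ^ 'n \<Rightarrow> real ^ 'n \<Rightarrow> bool" where
  "qp_solution a b l u y x \<longleftrightarrow> is_arg_min (objective y) (\<lambda>z. z \<in> feasible_set a b l u) x"

definition lagrangian :: "real ^ 'n \<Rightarrow> real \<Rightarrow> real ^ 'n \<Rightarrow> real \<Rightarrow> real ^ 'n \<Rightarrow> real" where
  "lagrangian a b y lam x = 1 / 2 * (x \<bullet> x) - y \<bullet> x + lam * (a \<bullet> x - b)"

text \<open>The Lagrangian contains only the equality constraint, so a KKT point is a pair of a primal
  point \<open>x\<close> and a multiplier \<open>lam\<close>. The multipliers \<open>m\<close> and \<open>k\<close> of the bounds \<open>l \<le> x\<close> and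
  \<open>x \<le> u\<close> are quantified away: they are not unique individually when \<open>l $ i = u $ i\<close>.\<close>

definition kkt_point ::
  "real ^ 'n \<Rightarrow> real \<Rightarrow> real ^ 'n \<Rightarrow> real ^ 'n \<Rightarrow> real ^ 'n \<Rightarrow> real ^ 'n \<Rightarrow> real \<Rightarrow> bool" where
  "kkt_point a b l u y x lam \<longleftrightarrow>
     l \<le> x \<and> x \<le> u \<and> a \<bullet> x = b \<and>
     (\<exists>m k. 0 \<le> m \<and> 0 \<le> k \<and>
        GDERIV (lagrangian a b y lam) x :> m - k \<and>
        (\<forall>i. m $ i * (x $ i - l $ i) = 0) \<and>
        (\<forall>i. k $ i * (u $ i - x $ i) = 0))"

definition h :: "real ^ 'n \<Rightarrow> real \<Rightarrow> real ^ 'n \<Rightarrow> real ^ 'n \<Rightarrow> real ^ 'n \<Rightarrow> real \<Rightarrow> real" where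
  "h a b l u y lam = b - (\<Sum>i\<in>UNIV. a $ i * mid (l $ i) (y $ i - lam * a $ i) (u $ i))"

text \<open>The function \<open>h\<close> is nondecreasing but may be constant on intervals, so its root need not be
  unique: for \<open>a = 0\<close>, \<open>b = 0\<close> every real is a root. Likewise for \<open>l = 0\<close>, \<open>u = (1, 1)\<close>,
  \<open>a = (1, 1)\<close>, \<open>b = 1\<close>, \<open>y = (10, -10)\<close>, every \<open>lam\<close> in \<open>[-10, 9]\<close> is a root and a multiplier.
  The following set collects the multipliers for which some component with \<open>a $ i \<noteq> 0\<close> is not
  cut off by its bounds. Around each of its interior points \<open>h\<close> is strictly increasing; on its
  complement \<open>h\<close> is locally constant. In particular, a root \<open>lam\<close> is interior as soon as the minimiser has a component
  strictly between its bounds with \<open>a $ i \<noteq> 0\<close> (the linear independence constraint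
  qualification, when \<open>l $ i < u $ i\<close> for all \<open>i\<close>).\<close>

definition unclipped :: "real ^ 'n \<Rightarrow> real ^ 'n \<Rightarrow> real ^ 'n \<Rightarrow> real ^ 'n \<Rightarrow> real set" where
  "unclipped a l u y =
     {lam. \<exists>i. a $ i \<noteq> 0 \<and> l $ i \<le> y $ i - lam * a $ i \<and> y $ i - lam * a $ i \<le> u $ i}"

end

theory Submission
  imports Defs
begin

text \<open>
  The stationarity condition at \<open>x\<close> with multiplier \<open>lam\<close> reads \<open>x - (y - lam *\<^sub>R a) = m - k\<close>.
  Together with the bounds and complementary slackness it decouples into scalar conditions, which
  say exactly that \<open>x\<close> is the componentwise clipping of \<open>y - lam *\<^sub>R a\<close> to the box; feasibility
  then amounts to \<open>h = 0\<close> (\<open>kkt_point_iff\<close>). A clipped point is the projection onto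
  the box, and moving along the hyperplane \<open>a \<bullet> x = b\<close> is blind to the shift by \<open>lam *\<^sub>R a\<close>. So the
  objective exceeds its value at a clipped feasible point by at least half the squared distance
  (\<open>objective_growth\<close>), which makes that point the unique minimiser. A root of the
  continuous function \<open>h\<close> exists by the intermediate value theorem: the clipped point minimises
  \<open>a \<bullet> x\<close> over the box when \<open>lam\<close> is large and maximises it when \<open>- lam\<close> is large, and \<open>b\<close> lies
  between these extreme values because the feasible set is non-empty.

  Roots are studied through the summands of \<open>h\<close>, each of which is monotone in \<open>lam\<close>. On
  each side of a point and close to it, a summand with \<open>a $ i \<noteq> 0\<close> is either unclipped or
  constant (\<open>clip_dichotomy\<close>). Hence if a root is not interior to the closed set \<open>unclipped\<close>, then
  \<open>h\<close> vanishes identically close to it on one side and the root is not unique. Conversely, two roots force every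
  summand to be constant between them. If one of the two is interior, then infinitely many points
  between them lie in \<open>unclipped\<close>, so by the pigeonhole principle two of these points are unclipped
  in the same component, and there the summand is strictly monotone.
\<close>

section \<open>Clipping and the optimality conditions\<close>

lemma h_eq_inner: "h a b l u y lam = b - a \<bullet> vmid l (y - lam *\<^sub>R a) u"
  by (simp add: h_def vmid_def inner_vec_def)

lemma mid_bounds: "l \<le> u \<Longrightarrow> l \<le> mid l v u \<and> mid l v u \<le> u"
  by (auto simp: mid_def)

lemma vmid_bounds:
  fixes l u v :: "real ^ 'n"
  assumes "l \<le> u"
  shows "l \<le> vmid l v u" "vmid l v u \<le> u"
  using assms by (simp_all add: less_eq_vec_def vmid_def mid_bounds)

lemma mid_iff_complementarity:
  assumes "l \<le> u"
  shows "x = mid l v u \<longleftrightarrow>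
    l \<le> x \<and> x \<le> u \<and>
    (\<exists>m k. 0 \<le> m \<and> 0 \<le> k \<and> x - v = m - k \<and> m * (x - l) = 0 \<and> k * (u - x) = 0)"
    (is "?L \<longleftrightarrow> ?R")
proof
  assume ?L
  then have "l \<le> x \<and> x \<le> u \<and> 0 \<le> max (x - v) 0 \<and> 0 \<le> max (v - x) 0 \<and>
      x - v = max (x - v) 0 - max (v - x) 0 \<and>
      max (x - v) 0 * (x - l) = 0 \<and> max (v - x) 0 * (u - x) = 0"
    using assms by (auto simp: mid_def max_def min_def)
  then show ?R
    by blast
next
  assume ?R
  then show ?L
    using assms by (auto simp: mid_def)
qed

lemma GDERIV_lagrangian: "GDERIV (lagrangian a b y lam) x :> x - (y - lam *\<^sub>R a)"
  unfolding gderiv_def lagrangian_def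
  by (auto intro!: derivative_eq_intros simp: fun_eq_iff inner_commute algebra_simps)

lemma GDERIV_unique:
  assumes "GDERIV f x :> D" "GDERIV f x :> E"
  shows "D = E"
proof -
  have "(\<lambda>z. z \<bullet> D) = (\<lambda>z. z \<bullet> E)"
    using assms unfolding gderiv_def by (rule has_derivative_unique)
  then show ?thesis
    by (metis vector_eq_ldot)
qed

lemma GDERIV_lagrangian_iff:
  "GDERIV (lagrangian a b y lam) x :> D \<longleftrightarrow> D = x - (y - lam *\<^sub>R a)"
  using GDERIV_lagrangian GDERIV_unique by blast

lemma kkt_point_iff:
  fixes l u :: "real ^ 'n"
  assumes "l \<le> u"
  shows "kkt_point a b l u y x lam \<longleftrightarrow>
    x = vmid l (y - lam *\<^sub>R a) u \<and> h a b l u y lam = 0"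
proof -
  let ?v = "y - lam *\<^sub>R a"
  have lu: "l $ i \<le> u $ i" for i
    using assms by (simp add: less_eq_vec_def)
  have "x = vmid l ?v u \<longleftrightarrow> (\<forall>i. x $ i = mid (l $ i) (?v $ i) (u $ i))"
    by (simp add: vmid_def vec_eq_iff)
  also have "\<dots> \<longleftrightarrow> l \<le> x \<and> x \<le> u \<and>
      (\<forall>i. \<exists>m k. 0 \<le> m \<and> 0 \<le> k \<and> x $ i - ?v $ i = m - k \<and>
        m * (x $ i - l $ i) = 0 \<and> k * (u $ i - x $ i) = 0)"
    unfolding mid_iff_complementarity[OF lu] less_eq_vec_def by blast
  also have "\<dots> \<longleftrightarrow> l \<le> x \<and> x \<le> u \<and>
      (\<exists>m k :: real ^ 'n. 0 \<le> m \<and> 0 \<le> k \<and> x - ?v = m - k \<and>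
        (\<forall>i. m $ i * (x $ i - l $ i) = 0) \<and> (\<forall>i. k $ i * (u $ i - x $ i) = 0))"
    (is "_ \<and> _ \<and> ?A \<longleftrightarrow> _ \<and> _ \<and> ?B")
  proof -
    have ?B if ?A
    proof -
      from that obtain m k where "\<forall>i. 0 \<le> m i \<and> 0 \<le> k i \<and> x $ i - ?v $ i = m i - k i \<and>
          m i * (x $ i - l $ i) = 0 \<and> k i * (u $ i - x $ i) = 0"
        by metis
      then show ?B
        by (intro exI[of _ "\<chi> i. m i"] exI[of _ "\<chi> i. k i"])
          (simp add: less_eq_vec_def vec_eq_iff)
    qed
    moreover have ?A if ?B
      using that by (metis less_eq_vec_def vector_minus_component zero_index)
    ultimately show ?thesis
      by blast
  qed
  finally have "x = vmid l ?v u \<longleftrightarrow> l \<le> x \<and> x \<le> u \<and>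
      (\<exists>m k :: real ^ 'n. 0 \<le> m \<and> 0 \<le> k \<and> x - ?v = m - k \<and>
        (\<forall>i. m $ i * (x $ i - l $ i) = 0) \<and> (\<forall>i. k $ i * (u $ i - x $ i) = 0))" .
  moreover have "x = vmid l ?v u \<Longrightarrow> h a b l u y lam = 0 \<longleftrightarrow> a \<bullet> x = b"
    by (auto simp: h_eq_inner)
  ultimately show ?thesis
    unfolding kkt_point_def GDERIV_lagrangian_iff by metis
qed

section \<open>The unique minimiser\<close>

lemma mid_variational:
  assumes "l \<le> z" "z \<le> u"
  shows "0 \<le> (mid l v u - v) * (z - mid l v u)"
  using assms by (auto simp: mid_def max_def min_def intro: mult_nonpos_nonpos)

text \<open>Since \<open>a \<bullet> (z - x) = 0\<close> for feasible \<open>z\<close> and \<open>x\<close>, replacing \<open>y\<close> by \<open>y - lam *\<^sub>R a\<close> does not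
  change the linear term, and the variational inequality of the clipping applies to it.\<close>

lemma objective_growth:
  fixes x z :: "real ^ 'n"
  assumes x: "x = vmid l (y - lam *\<^sub>R a) u" "a \<bullet> x = b" and z: "z \<in> feasible_set a b l u"
  shows "objective y x + 1 / 2 * (norm (z - x))\<^sup>2 \<le> objective y z"
proof -
  let ?v = "y - lam *\<^sub>R a"
  have "0 \<le> (x - ?v) \<bullet> (z - x)"
    unfolding inner_vec_def
  proof (rule sum_nonneg)
    fix i
    show "0 \<le> (x - ?v) $ i \<bullet> (z - x) $ i"
      using mid_variational[of "l $ i" "z $ i" "u $ i" "?v $ i"] z
      by (simp add: x(1) vmid_def feasible_set_def less_eq_vec_def)
  qed
  also have "(x - ?v) \<bullet> (z - x) = (x - y) \<bullet> (z - x) + lam * (a \<bullet> z - a \<bullet> x)"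
    by (simp add: algebra_simps)
  also have "a \<bullet> z - a \<bullet> x = 0"
    using x(2) z by (simp add: feasible_set_def)
  finally have "0 \<le> (x - y) \<bullet> (z - x)"
    by simp
  then show ?thesis
    by (simp add: objective_def power2_norm_eq_inner algebra_simps inner_commute)
qed

lemma qp_solution_iff_vmid:
  fixes l u :: "real ^ 'n"
  assumes "l \<le> u" and root: "h a b l u y lam = 0"
  shows "qp_solution a b l u y x \<longleftrightarrow> x = vmid l (y - lam *\<^sub>R a) u"
proof -
  define p where "p = vmid l (y - lam *\<^sub>R a) u"
  have ap: "a \<bullet> p = b"
    using root by (simp add: p_def h_eq_inner)
  then have feas: "p \<in> feasible_set a b l u"
    using vmid_bounds[OF \<open>l \<le> u\<close>] by (simp add: p_def feasible_set_def)
  have growth: "objective y p + 1 / 2 * (norm (z - p))\<^sup>2 \<le> objective y z"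
    if "z \<in> feasible_set a b l u" for z
    using objective_growth[OF p_def ap that] .
  have "objective y p \<le> objective y z" if "z \<in> feasible_set a b l u" for z
    using growth[OF that] zero_le_power2[of "norm (z - p)"] by linarith
  then have "qp_solution a b l u y p"
    using feas by (auto simp: qp_solution_def is_arg_min_linorder)
  moreover have "z = p" if "qp_solution a b l u y z" for z
  proof -
    have "z \<in> feasible_set a b l u" "objective y z \<le> objective y p"
      using that feas by (auto simp: qp_solution_def is_arg_min_linorder)
    then have "(norm (z - p))\<^sup>2 \<le> 0"
      using growth[of z] by linarith
    then show ?thesis
      by simp
  qed
  ultimately show ?thesis
    unfolding p_def[symmetric] by blast
qed

section \<open>Existence of a root\<close>

lemma mid_mono: "v \<le> w \<Longrightarrow> mid l v u \<le> mid l w u"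
  unfolding mid_def by (intro max.mono min.mono order_refl)

lemma clip_term_antimono:
  assumes "s \<le> t"
  shows "a * mid l (y - t * a) u \<le> a * mid l (y - s * a) u"
proof (cases "0 \<le> a")
  case True
  then have "s * a \<le> t * a"
    using assms by (rule mult_right_mono[rotated])
  with True show ?thesis
    by (intro mult_left_mono mid_mono) auto
next
  case False
  then have "t * a \<le> s * a"
    using assms by (intro mult_right_mono_neg) auto
  with False show ?thesis
    by (intro mult_left_mono_neg mid_mono) auto
qed

lemma mono_h: "mono (h a b l u y)"
  by (auto intro!: monoI sum_mono clip_term_antimono simp: h_def)

lemma continuous_on_h: "continuous_on S (h a b l u y)"
  unfolding h_def mid_def by (intro continuous_intros continuous_on_max continuous_on_min)

text \<open>Reversing the signs of \<open>a\<close>, \<open>b\<close> and \<open>lam\<close> leaves the feasible set and the clipped points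
  unchanged; it turns the lower estimate of \<open>h\<close> into an upper one.\<close>

lemma h_uminus: "h (- a) (- b) l u y (- lam) = - h a b l u y lam"
  by (simp add: h_def sum_negf)

lemma ex_h_nonneg:
  assumes "feasible_set a b l u \<noteq> {}"
  shows "\<exists>lam. 0 \<le> h a b l u y lam"
proof -
  obtain z where z: "l \<le> z" "z \<le> u" "a \<bullet> z = b"
    using assms by (auto simp: feasible_set_def)
  have "\<forall>\<^sub>F t in at_top. a $ i * mid (l $ i) (y $ i - t * a $ i) (u $ i) \<le> a $ i * z $ i" for i
  proof -
    have zi: "l $ i \<le> z $ i" "z $ i \<le> u $ i"
      using z by (simp_all add: less_eq_vec_def)
    consider "a $ i = 0" | "a $ i > 0" | "a $ i < 0"
      by linarith
    then show ?thesis
    proof cases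
      case 1
      then show ?thesis
        by simp
    next
      case 2
      show ?thesis
        using eventually_ge_at_top[of "(y $ i - l $ i) / a $ i"]
      proof eventually_elim
        case (elim t)
        then have "y $ i - t * a $ i \<le> l $ i"
          using 2 by (simp add: field_simps)
        then show ?case
          using 2 zi by (auto simp: mid_def)
      qed
    next
      case 3
      show ?thesis
        using eventually_ge_at_top[of "(y $ i - u $ i) / a $ i"]
      proof eventually_elim
        case (elim t)
        then have "u $ i \<le> y $ i - t * a $ i"
          using 3 by (simp add: field_simps)
        then show ?case
          using 3 zi by (auto simp: mid_def)
      qed
    qed
  qed
  then have "\<forall>\<^sub>F t in at_top. \<forall>i. a $ i * mid (l $ i) (y $ i - t * a $ i) (u $ i) \<le> a $ i * z $ i"
    by (rule eventually_all_finite)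
  then obtain t where "\<And>i. a $ i * mid (l $ i) (y $ i - t * a $ i) (u $ i) \<le> a $ i * z $ i"
    using eventually_happens'[OF trivial_limit_at_top_linorder] by blast
  then have "(\<Sum>i\<in>UNIV. a $ i * mid (l $ i) (y $ i - t * a $ i) (u $ i)) \<le> a \<bullet> z"
    unfolding inner_vec_def by (intro sum_mono) simp
  then show ?thesis
    using z by (auto simp: h_def intro!: exI[of _ t])
qed

lemma ex_h_root:
  assumes "feasible_set a b l u \<noteq> {}"
  shows "\<exists>lam. h a b l u y lam = 0"
proof -
  obtain t where t: "0 \<le> h a b l u y t"
    using ex_h_nonneg[OF assms] by blast
  have "feasible_set (- a) (- b) l u \<noteq> {}"
    using assms by (simp add: feasible_set_def)
  then obtain s' where "0 \<le> h (- a) (- b) l u y s'"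
    using ex_h_nonneg by blast
  then have s: "h a b l u y (- s') \<le> 0"
    using h_uminus[of a b l u y "- s'"] by simp
  show ?thesis
  proof (cases "- s' \<le> t")
    case True
    then show ?thesis
      using IVT'[OF s t _ continuous_on_h] by blast
  next
    case False
    then have "h a b l u y t \<le> h a b l u y (- s')"
      by (intro monoD[OF mono_h]) simp
    then show ?thesis
      using s t by (intro exI[of _ t]) simp
  qed
qed

section \<open>Uniqueness of the root\<close>

text \<open>The function \<open>f\<close> approaches \<open>v\<close> strictly from one side. For the affine functions
  \<open>\<lambda>t. y $ i - t * a $ i\<close> with \<open>a $ i \<noteq> 0\<close> this covers both one-sided limits and both signs of
  \<open>a $ i\<close>.\<close>

lemma clip_dichotomy:
  assumes "(f \<longlongrightarrow> v) F" and "(\<forall>\<^sub>F t in F. f t < v) \<or> (\<forall>\<^sub>F t in F. v < f t)" and "l \<le> u"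
  shows "(\<forall>\<^sub>F t in F. l \<le> f t \<and> f t \<le> u) \<or> (\<forall>\<^sub>F t in F. mid l (f t) u = mid l v u)"
proof -
  have below: "\<forall>\<^sub>F t in F. f t < c" if "v < c" for c
    using order_tendstoD(2)[OF assms(1) that] .
  have above: "\<forall>\<^sub>F t in F. c < f t" if "c < v" for c
    using order_tendstoD(1)[OF assms(1) that] .
  from assms(2) show ?thesis
  proof
    assume side: "\<forall>\<^sub>F t in F. f t < v"
    consider "v \<le> l" | "l < v" "v \<le> u" | "u < v"
      by linarith
    then show ?thesis
    proof cases
      case 1
      have "\<forall>\<^sub>F t in F. mid l (f t) u = mid l v u"
        using side by eventually_elim (use 1 in \<open>auto simp: mid_def\<close>)
      then show ?thesis ..
    next
      case 2
      have "\<forall>\<^sub>F t in F. l \<le> f t \<and> f t \<le> u"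
        using side above[OF 2(1)] by eventually_elim (use 2 in auto)
      then show ?thesis ..
    next
      case 3
      have "\<forall>\<^sub>F t in F. mid l (f t) u = mid l v u"
        using above[OF 3] by eventually_elim (use 3 in \<open>auto simp: mid_def\<close>)
      then show ?thesis ..
    qed
  next
    assume side: "\<forall>\<^sub>F t in F. v < f t"
    consider "u \<le> v" | "v < u" "l \<le> v" | "v < l"
      by linarith
    then show ?thesis
    proof cases
      case 1
      have "\<forall>\<^sub>F t in F. mid l (f t) u = mid l v u"
        using side by eventually_elim (use 1 in \<open>auto simp: mid_def\<close>)
      then show ?thesis ..
    next
      case 2
      have "\<forall>\<^sub>F t in F. l \<le> f t \<and> f t \<le> u"
        using side below[OF 2(1)] by eventually_elim (use 2 in auto)
      then show ?thesis ..
    next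
      case 3
      have "\<forall>\<^sub>F t in F. mid l (f t) u = mid l v u"
        using below[OF 3] by eventually_elim (use 3 \<open>l \<le> u\<close> in \<open>auto simp: mid_def\<close>)
      then show ?thesis ..
    qed
  qed
qed

lemma unclipped_or_h_constant:
  fixes l u :: "real ^ 'n"
  assumes "l \<le> u" and F: "F = at_left lam \<or> F = at_right lam"
  shows "(\<forall>\<^sub>F t in F. t \<in> unclipped a l u y) \<or> (\<forall>\<^sub>F t in F. h a b l u y t = h a b l u y lam)"
proof (rule disjCI)
  assume not_const: "\<not> (\<forall>\<^sub>F t in F. h a b l u y t = h a b l u y lam)"
  have "\<exists>i. \<not> (\<forall>\<^sub>F t in F. a $ i * mid (l $ i) (y $ i - t * a $ i) (u $ i) =
      a $ i * mid (l $ i) (y $ i - lam * a $ i) (u $ i))"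
  proof (rule ccontr)
    assume "\<not> ?thesis"
    then have "\<forall>\<^sub>F t in F. \<forall>i. a $ i * mid (l $ i) (y $ i - t * a $ i) (u $ i) =
        a $ i * mid (l $ i) (y $ i - lam * a $ i) (u $ i)"
      by (intro eventually_all_finite) blast
    then have "\<forall>\<^sub>F t in F. h a b l u y t = h a b l u y lam"
      unfolding h_def by eventually_elim (auto intro: sum.cong)
    with not_const show False
      by blast
  qed
  then obtain i where i: "\<not> (\<forall>\<^sub>F t in F. a $ i * mid (l $ i) (y $ i - t * a $ i) (u $ i) =
      a $ i * mid (l $ i) (y $ i - lam * a $ i) (u $ i))" ..
  then have ai: "a $ i \<noteq> 0"
    by auto
  define f where "f = (\<lambda>t. y $ i - t * a $ i)"
  have lim: "(f \<longlongrightarrow> f lam) F"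
    using F unfolding f_def by (auto intro!: tendsto_intros)
  have mono: "f s < f t" if "s < t" "a $ i < 0" for s t
    using that by (simp add: f_def)
  have antimono: "f t < f s" if "s < t" "a $ i > 0" for s t
    using that by (simp add: f_def)
  have order: "(\<forall>\<^sub>F t in F. t < lam) \<or> (\<forall>\<^sub>F t in F. lam < t)"
    using F by (auto simp: eventually_at_filter)
  have side: "(\<forall>\<^sub>F t in F. f t < f lam) \<or> (\<forall>\<^sub>F t in F. f lam < f t)"
  proof (cases "a $ i < 0")
    case True
    from order show ?thesis
      by (rule disj_forward) (auto elim!: eventually_mono intro: mono True)
  next
    case False
    with ai have "a $ i > 0"
      by simp
    then show ?thesis
      using order[THEN disj_commute[THEN iffD1]]
      by (elim disj_forward) (auto elim!: eventually_mono intro: antimono)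
  qed
  have "l $ i \<le> u $ i"
    using \<open>l \<le> u\<close> by (simp add: less_eq_vec_def)
  from clip_dichotomy[OF lim side this] show "\<forall>\<^sub>F t in F. t \<in> unclipped a l u y"
  proof
    assume "\<forall>\<^sub>F t in F. l $ i \<le> f t \<and> f t \<le> u $ i"
    then show ?thesis
      by eventually_elim (use ai in \<open>auto simp: unclipped_def f_def\<close>)
  next
    assume "\<forall>\<^sub>F t in F. mid (l $ i) (f t) (u $ i) = mid (l $ i) (f lam) (u $ i)"
    then have "\<forall>\<^sub>F t in F. a $ i * mid (l $ i) (y $ i - t * a $ i) (u $ i) =
        a $ i * mid (l $ i) (y $ i - lam * a $ i) (u $ i)"
      by eventually_elim (simp add: f_def)
    with i show ?thesis
      by blast
  qed
qed

lemma closed_unclipped: "closed (unclipped a l u y)"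
proof -
  have "closed {lam. a $ i \<noteq> 0 \<and> l $ i \<le> y $ i - lam * a $ i \<and> y $ i - lam * a $ i \<le> u $ i}" for i
    by (intro closed_Collect_conj closed_Collect_le closed_Collect_const continuous_intros)
  then have "closed (\<Union>i. {lam. a $ i \<noteq> 0 \<and> l $ i \<le> y $ i - lam * a $ i \<and>
      y $ i - lam * a $ i \<le> u $ i})"
    by (intro closed_UN) auto
  also have "(\<Union>i. {lam. a $ i \<noteq> 0 \<and> l $ i \<le> y $ i - lam * a $ i \<and>
      y $ i - lam * a $ i \<le> u $ i}) = unclipped a l u y"
    by (auto simp: unclipped_def)
  finally show ?thesis .
qed

lemma unique_root_imp_interior:
  fixes l u :: "real ^ 'n"
  assumes "l \<le> u" and root: "h a b l u y lam = 0"
    and unique: "\<And>t. h a b l u y t = 0 \<Longrightarrow> t = lam"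
  shows "lam \<in> interior (unclipped a l u y)"
proof -
  let ?U = "unclipped a l u y"
  have one_side: "\<forall>\<^sub>F t in F. t \<in> ?U" if F: "F = at_left lam \<or> F = at_right lam" for F
  proof (rule ccontr)
    assume "\<not> ?thesis"
    then have "\<forall>\<^sub>F t in F. h a b l u y t = h a b l u y lam"
      using unclipped_or_h_constant[OF \<open>l \<le> u\<close> F] by blast
    then have "\<forall>\<^sub>F t in F. t = lam"
      by (rule eventually_mono) (intro unique, simp add: root)
    moreover have "\<forall>\<^sub>F t in F. t \<noteq> lam"
      using F by (auto simp: eventually_at_filter)
    ultimately have "\<forall>\<^sub>F t in F. False"
      by eventually_elim simp
    with F show False
      by auto
  qed
  have right: "\<forall>\<^sub>F t in at_right lam. t \<in> ?U" and left: "\<forall>\<^sub>F t in at_left lam. t \<in> ?U"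
    by (simp_all add: one_side)
  have "lam \<in> ?U"
    by (rule Lim_in_closed_set[OF closed_unclipped right]) auto
  moreover have "\<forall>\<^sub>F t in at lam. t \<in> ?U"
    using left right by (simp add: eventually_at_split)
  ultimately have "\<forall>\<^sub>F t in nhds lam. t \<in> ?U"
    by (simp add: eventually_nhds_conv_at)
  then show ?thesis
    by (auto simp: eventually_nhds interior_def)
qed

text \<open>A component with equal bounds contributes at most one point to \<open>unclipped\<close>, at which \<open>h\<close>
  need not increase. This is why infinitely many unclipped points are required.\<close>

lemma h_less_if_infinite_unclipped:
  assumes "infinite ({s<..<t} \<inter> unclipped a l u y)"
  shows "h a b l u y s < h a b l u y t"
proof -
  let ?g = "\<lambda>i t. a $ i * mid (l $ i) (y $ i - t * a $ i) (u $ i)"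
  let ?V = "\<lambda>i. {s<..<t} \<inter>
    {r. a $ i \<noteq> 0 \<and> l $ i \<le> y $ i - r * a $ i \<and> y $ i - r * a $ i \<le> u $ i}"
  have "{s<..<t} \<inter> unclipped a l u y = (\<Union>i. ?V i)"
    by (auto simp: unclipped_def)
  then have "infinite (\<Union>i. ?V i)"
    using assms by simp
  moreover have "finite (\<Union>i. ?V i)" if "\<And>i. finite (?V i)"
    using that by (rule finite_UN_I[OF finite])
  ultimately obtain i where inf: "infinite (?V i)"
    by blast
  then obtain p where p: "p \<in> ?V i"
    by (metis (no_types, lifting) finite.emptyI ex_in_conv)
  have "?V i - {p} \<noteq> {}"
    using inf by (metis (no_types, lifting) finite.emptyI infinite_remove)
  then obtain q where q: "q \<in> ?V i" "q \<noteq> p"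
    by blast
  define c d where "c = min p q" and "d = max p q"
  have cd: "c \<in> ?V i" "d \<in> ?V i" "c < d"
    using p q by (auto simp: c_def d_def min_def max_def)
  have ai: "0 < a $ i * a $ i"
    using cd(1) by (auto simp: zero_less_mult_iff)
  have "?g i d = a $ i * y $ i - d * (a $ i * a $ i)"
    using cd(2) by (simp add: mid_def algebra_simps)
  also have "\<dots> < a $ i * y $ i - c * (a $ i * a $ i)"
    using mult_strict_right_mono[OF cd(3) ai] by linarith
  also have "\<dots> = ?g i c"
    using cd(1) by (simp add: mid_def algebra_simps)
  finally have "?g i d < ?g i c" .
  moreover have "?g i t \<le> ?g i d" "?g i c \<le> ?g i s"
    using cd by (auto intro!: clip_term_antimono)
  ultimately have "?g i t < ?g i s"
    by linarith
  moreover have "?g j t \<le> ?g j s" for j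
    using cd by (intro clip_term_antimono) auto
  ultimately have "(\<Sum>j\<in>UNIV. ?g j t) < (\<Sum>j\<in>UNIV. ?g j s)"
    by (intro sum_strict_mono_ex1 ballI bexI[of _ i]) auto
  then show ?thesis
    by (simp add: h_def)
qed

lemma interior_root_unique:
  assumes int: "lam \<in> interior (unclipped a l u y)"
    and eq: "h a b l u y lam = h a b l u y t"
  shows "t = lam"
proof (rule ccontr)
  assume "t \<noteq> lam"
  obtain e where e: "0 < e" "ball lam e \<subseteq> unclipped a l u y"
    using int by (auto simp: mem_interior)
  consider "lam < t" | "t < lam"
    using \<open>t \<noteq> lam\<close> by linarith
  then show False
  proof cases
    case 1
    have "{lam<..<min t (lam + e)} \<subseteq> {lam<..<t} \<inter> unclipped a l u y"
      using e(2) by (force simp: dist_real_def)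
    moreover have "infinite {lam<..<min t (lam + e)}"
      using 1 e(1) by (intro infinite_Ioo) simp
    ultimately have "infinite ({lam<..<t} \<inter> unclipped a l u y)"
      by (rule infinite_super)
    from h_less_if_infinite_unclipped[OF this, of b] eq show False
      by simp
  next
    case 2
    have "{max t (lam - e)<..<lam} \<subseteq> {t<..<lam} \<inter> unclipped a l u y"
      using e(2) by (force simp: dist_real_def)
    moreover have "infinite {max t (lam - e)<..<lam}"
      using 2 e(1) by (intro infinite_Ioo) simp
    ultimately have "infinite ({t<..<lam} \<inter> unclipped a l u y)"
      by (rule infinite_super)
    from h_less_if_infinite_unclipped[OF this, of b] eq show False
      by simp
  qed
qed

lemma ex1_root_iff:
  fixes l u :: "real ^ 'n"
  assumes "l \<le> u"
  shows "(\<exists>!lam. h a b l u y lam = 0) \<longleftrightarrow>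
    (\<exists>lam \<in> interior (unclipped a l u y). h a b l u y lam = 0)"
proof
  assume "\<exists>!lam. h a b l u y lam = 0"
  then show "\<exists>lam \<in> interior (unclipped a l u y). h a b l u y lam = 0"
    using unique_root_imp_interior[OF assms] by metis
next
  assume "\<exists>lam \<in> interior (unclipped a l u y). h a b l u y lam = 0"
  then show "\<exists>!lam. h a b l u y lam = 0"
    using interior_root_unique by metis
qed

section \<open>The projection as a clipped point\<close>

theorem theorem2p2:
  fixes a l u y :: "real ^ 'n" and b :: real
  assumes "l \<le> u"
    and "feasible_set a b l u \<noteq> {}"
  shows "(\<exists>!x. qp_solution a b l u y x) \<and>
    (\<exists>x lam. kkt_point a b l u y x lam) \<and>
    (\<forall>x lam. kkt_point a b l u y x lam \<longleftrightarrow> qp_solution a b l u y x \<and> h a b l u y lam = 0) \<and>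
    (\<forall>x lam. kkt_point a b l u y x lam \<longrightarrow> x = vmid l (y - lam *\<^sub>R a) u) \<and>
    ((\<exists>!lam. h a b l u y lam = 0) \<longleftrightarrow>
       (\<exists>lam \<in> interior (unclipped a l u y). h a b l u y lam = 0)) \<and>
    ((\<exists>!p. kkt_point a b l u y (fst p) (snd p)) \<longleftrightarrow>
       (\<exists>lam \<in> interior (unclipped a l u y). h a b l u y lam = 0))"
proof -
  obtain lam0 where lam0: "h a b l u y lam0 = 0"
    using ex_h_root[OF assms(2)] by blast
  note sol = qp_solution_iff_vmid[OF assms(1)] and kkt = kkt_point_iff[OF assms(1)]
  have 1: "\<exists>!x. qp_solution a b l u y x"
    using sol[OF lam0] by simp
  have 2: "\<exists>x lam. kkt_point a b l u y x lam"
    using kkt lam0 by blast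
  have 3: "\<forall>x lam. kkt_point a b l u y x lam \<longleftrightarrow> qp_solution a b l u y x \<and> h a b l u y lam = 0"
    using sol kkt by blast
  have 4: "\<forall>x lam. kkt_point a b l u y x lam \<longrightarrow> x = vmid l (y - lam *\<^sub>R a) u"
    using kkt by blast
  have 5: "(\<exists>!p. kkt_point a b l u y (fst p) (snd p)) \<longleftrightarrow> (\<exists>!lam. h a b l u y lam = 0)"
  proof
    assume "\<exists>!p. kkt_point a b l u y (fst p) (snd p)"
    then show "\<exists>!lam. h a b l u y lam = 0"
      unfolding kkt by (metis fst_conv snd_conv)
  next
    assume "\<exists>!lam. h a b l u y lam = 0"
    then show "\<exists>!p. kkt_point a b l u y (fst p) (snd p)"
      unfolding kkt by (metis fst_conv snd_conv prod_eqI)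
  qed
  show ?thesis
    unfolding 5 ex1_root_iff[OF assms(1)] using 1 2 3 4 by blast
qed

end
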